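(* There exist positive absolute constants $c_1$ and $c_2$ such that the following holds for all positive integers $k,d,s$ with $s<d$ and all $a>0$, $\sigma>0$. If $d-s\ge c_2$ and $$a^{2} < c_1\sigma^2 \max\big(\log(d-s),\ \sqrt{k\log(d-s)}\big)$$ then $$\inf_{\tilde\eta} \sup_{\theta \in \Theta_{k,d} (s,a)} \mathbf{E}_\theta |\tilde \eta - \eta(\theta)|\ge \inf_{\tilde\eta} \sup_{\theta \in \Theta_{k,d} (s,a)} \mathbf{P}_\theta (S_{\tilde \eta} \ne S_{\eta(\theta)})\ge (1-e^{-1})^2.$$ If $d/s\ge c_2$ and $$a^{2} < c_1\sigma^2\max\big(\log((d-s)/s),\ \sqrt{k\log((d-s)/s)}\big)$$ then $$\inf_{\tilde\eta} \sup_{\theta \in \Theta_{k,d} (s,a)} \frac1s\mathbf{E}_\theta |\tilde \eta - \eta(\theta)|\ge \frac{ 1-e^{-1}}{2}.$$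
   Context: Gaussian matrix model: one observes $Y_{ij}=\theta_{ij}+\sigma\xi_{ij}$, $i=1,\dots,k$, $j=1,\dots,d$ ($d>2$), where $\xi_{ij}$ are i.i.d. standard normal and $\sigma>0$. $\theta_j\in\mathbb{R}^k$ denotes the $j$th column of $\theta\in\mathbb{R}^{k\times d}$ and $\|\cdot\|$ is the Euclidean norm. The parameter class is $$\Theta_{k,d}(s,a)=\{\theta\in\mathbb{R}^{k\times d}:\ \exists S\subset\{1,\dots,d\},\ |S|=s,\ \|\theta_j\|\ge a\ \text{for } j\in S,\ \theta_j=0\ \text{for } j\notin S\}.$$ $\eta(\theta)\in\{0,1\}^d$ has components $\eta_j(\theta)=\mathbf{1}(\theta_j\ne0)$. $\mathbf{P}_\theta,\mathbf{E}_\theta$ are the probability and expectation for the observations $(Y_{ij})$. A selector is a measurable function of the observations (possibly also of an independent randomization variable) with values in $\{0,1\}^d$; $\inf_{\tilde\eta}$ is over all selectors. $|\tilde\eta-\eta|=\sum_{j=1}^d\mathbf{1}(\tilde\eta_j\neq\eta_j)$; $S_\eta=\{j:\eta_j\neq0\}$. *)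

theory Defs
  imports "HOL-Probability.Probability"
begin

text \<open>A \<open>k \<times> d\<close> real matrix is an extensional function on \<open>{1..k} \<times> {1..d}\<close>, the first
  coordinate being the row index.\<close>

abbreviation entries :: "nat \<Rightarrow> nat \<Rightarrow> (nat \<times> nat) set" where
  "entries k d \<equiv> {1..k} \<times> {1..d}"

abbreviation matrix_space :: "nat \<Rightarrow> nat \<Rightarrow> (nat \<times> nat \<Rightarrow> real) measure" where
  "matrix_space k d \<equiv> (\<Pi>\<^sub>M _\<in>entries k d. borel)"

definition column_norm :: "nat \<Rightarrow> (nat \<times> nat \<Rightarrow> real) \<Rightarrow> nat \<Rightarrow> real" where
  "column_norm k \<theta> j = L2_set (\<lambda>i. \<theta> (i, j)) {1..k}"

definition column_zero :: "nat \<Rightarrow> (nat \<times> nat \<Rightarrow> real) \<Rightarrow> nat \<Rightarrow> bool" where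
  "column_zero k \<theta> j \<longleftrightarrow> (\<forall>i\<in>{1..k}. \<theta> (i, j) = 0)"

definition Theta :: "nat \<Rightarrow> nat \<Rightarrow> nat \<Rightarrow> real \<Rightarrow> (nat \<times> nat \<Rightarrow> real) set" where
  "Theta k d s a = {\<theta> \<in> entries k d \<rightarrow>\<^sub>E UNIV.
     \<exists>S\<subseteq>{1..d}. card S = s \<and> (\<forall>j\<in>S. a \<le> column_norm k \<theta> j)
                \<and> (\<forall>j\<in>{1..d} - S. column_zero k \<theta> j)}"

definition eta :: "nat \<Rightarrow> nat \<Rightarrow> (nat \<times> nat \<Rightarrow> real) \<Rightarrow> nat \<Rightarrow> nat" where
  "eta k d \<theta> = (\<lambda>j\<in>{1..d}. of_bool (\<not> column_zero k \<theta> j))"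

definition noise_law :: "nat \<Rightarrow> nat \<Rightarrow> (nat \<times> nat \<Rightarrow> real) measure" where
  "noise_law k d = (\<Pi>\<^sub>M _\<in>entries k d. density lborel (\<lambda>x. ennreal (std_normal_density x)))"

definition obs_law :: "nat \<Rightarrow> nat \<Rightarrow> real \<Rightarrow> (nat \<times> nat \<Rightarrow> real) \<Rightarrow> (nat \<times> nat \<Rightarrow> real) measure" where
  "obs_law k d \<sigma> \<theta> =
     distr (noise_law k d) (matrix_space k d) (\<lambda>\<xi>. \<lambda>ij\<in>entries k d. \<theta> ij + \<sigma> * \<xi> ij)"

text \<open>A randomized selector is a pair of a law \<open>\<nu>\<close> for the randomization variable and a measurable
  map of the observations and of that variable. Since \<open>{0,1}\<close>-vectors of length \<open>d\<close> form a finite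
  set, real-valued randomization is no restriction. Non-randomized selectors are the maps that
  ignore their second argument.\<close>

type_synonym selector = "real measure \<times> ((nat \<times> nat \<Rightarrow> real) \<times> real \<Rightarrow> nat \<Rightarrow> nat)"

definition selectors :: "nat \<Rightarrow> nat \<Rightarrow> selector set" where
  "selectors k d = {(\<nu>, T). prob_space \<nu> \<and> sets \<nu> = sets borel \<and>
     T \<in> measurable (matrix_space k d \<Otimes>\<^sub>M borel) (count_space ({1..d} \<rightarrow>\<^sub>E {0, 1}))}"

definition hamming :: "nat \<Rightarrow> (nat \<Rightarrow> nat) \<Rightarrow> (nat \<Rightarrow> nat) \<Rightarrow> nat" where
  "hamming d \<eta> \<eta>' = (\<Sum>j=1..d. of_bool (\<eta> j \<noteq> \<eta>' j))"

definition supp :: "nat \<Rightarrow> (nat \<Rightarrow> nat) \<Rightarrow> nat set" where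
  "supp d \<eta> = {j\<in>{1..d}. \<eta> j \<noteq> 0}"

definition joint_law ::
  "nat \<Rightarrow> nat \<Rightarrow> real \<Rightarrow> (nat \<times> nat \<Rightarrow> real) \<Rightarrow> real measure \<Rightarrow> ((nat \<times> nat \<Rightarrow> real) \<times> real) measure" where
  "joint_law k d \<sigma> \<theta> \<nu> = obs_law k d \<sigma> \<theta> \<Otimes>\<^sub>M \<nu>"

text \<open>Both risks take values in \<open>[0,\<infinity>]\<close>, so that all infima and suprema exist unconditionally.\<close>

definition hamming_risk :: "nat \<Rightarrow> nat \<Rightarrow> real \<Rightarrow> selector \<Rightarrow> (nat \<times> nat \<Rightarrow> real) \<Rightarrow> ennreal" where
  "hamming_risk k d \<sigma> = (\<lambda>(\<nu>, T) \<theta>.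
     \<integral>\<^sup>+ \<omega>. of_nat (hamming d (T \<omega>) (eta k d \<theta>)) \<partial>joint_law k d \<sigma> \<theta> \<nu>)"

definition support_error :: "nat \<Rightarrow> nat \<Rightarrow> real \<Rightarrow> selector \<Rightarrow> (nat \<times> nat \<Rightarrow> real) \<Rightarrow> ennreal" where
  "support_error k d \<sigma> = (\<lambda>(\<nu>, T) \<theta>.
     emeasure (joint_law k d \<sigma> \<theta> \<nu>)
       {\<omega> \<in> space (joint_law k d \<sigma> \<theta> \<nu>). supp d (T \<omega>) \<noteq> supp d (eta k d \<theta>)})"

end

theory Submission
  imports Defs
begin

text \<open>Give the active columns the entries \<open>\<plusminus>a / sqrt k\<close> with independent uniform signs. Averaging
  over the signs, the likelihood ratio of an active column against pure noise has second moment
  \<open>cosh (a\<^sup>2 / (k \<sigma>\<^sup>2)) ^ k\<close>. From \<open>cosh x \<le> exp \<bar>x\<bar>\<close> and \<open>cosh x \<le> exp (x\<^sup>2)\<close> it follows that, for \<open>a\<close>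
  below the threshold, this is at most the square root of the number \<open>m\<close> of candidate positions.
  By the second moment method, an active column hidden uniformly among \<open>m\<close> positions is then
  missed with probability at least \<open>1/2\<close>.

  For the support error, \<open>s - 1\<close> active columns are fixed and one is hidden among the remaining
  \<open>d - s + 1\<close> positions. For the Hamming risk, one active column is hidden in each of \<open>s\<close> disjoint
  blocks of length \<open>d div s\<close>, and each misidentified block costs at least one error.\<close>

section \<open>Elementary bounds on the hyperbolic cosine\<close>

lemma cosh_le_exp_abs: "cosh x \<le> exp \<bar>x\<bar>" for x :: real
proof -
  have "exp x \<le> exp \<bar>x\<bar>" "exp (-x) \<le> exp \<bar>x\<bar>" unfolding exp_le_cancel_iff by simp_all
  then have "exp x + exp (-x) \<le> exp \<bar>x\<bar> + exp \<bar>x\<bar>" by (rule add_mono)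
  then show ?thesis unfolding cosh_field_def by simp
qed

text \<open>On \<open>[0, 1]\<close> the linear terms in quadratic upper bounds for
  \<open>exp x\<close> and \<open>exp (-x)\<close> cancel. Beyond 1, \<open>\<bar>x\<bar>\<close> is
  at most its square and the bound by \<open>exp \<bar>x\<bar>\<close> is enough.\<close>

lemma cosh_le_exp_square: "cosh x \<le> exp (x\<^sup>2)" for x :: real
proof -
  have *: "cosh x \<le> exp (x\<^sup>2)" if x: "0 \<le> x" "x \<le> 1" for x :: real
  proof -
    \<comment> \<open>The product equals \<open>1 + x^3\<close>; it yields a quadratic upper bound
      for \<open>exp (-x)\<close>.\<close>
    have "1 \<le> (1 + x) * (1 - x + x\<^sup>2)"
      using x by (simp add: algebra_simps power2_eq_square)
    also have "\<dots> \<le> exp x * (1 - x + x\<^sup>2)"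
      using x exp_ge_add_one_self[of x] by (intro mult_right_mono) auto
    finally have "exp (-x) \<le> 1 - x + x\<^sup>2"
      by (simp add: exp_minus field_simps)
    moreover have "exp x \<le> 1 + x + x\<^sup>2" using x by (rule exp_bound)
    moreover have "1 + x\<^sup>2 \<le> exp (x\<^sup>2)" by (rule exp_ge_add_one_self)
    ultimately have "exp x + exp (-x) \<le> exp (x\<^sup>2) + exp (x\<^sup>2)" by argo
    then show ?thesis unfolding cosh_field_def by simp
  qed
  show ?thesis
  proof (cases "\<bar>x\<bar> \<le> 1")
    case True
    then show ?thesis using *[of "\<bar>x\<bar>"] by (simp add: abs_if split: if_splits)
  next
    case False
    then have "\<bar>x\<bar> \<le> \<bar>x\<bar> * \<bar>x\<bar>" using mult_left_mono[of 1 "\<bar>x\<bar>" "\<bar>x\<bar>"] by simp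
    then have "exp \<bar>x\<bar> \<le> exp (x\<^sup>2)" by (simp add: power2_eq_square)
    then show ?thesis using cosh_le_exp_abs[of x] by linarith
  qed
qed

text \<open>The left-hand side is the second moment of the likelihood ratio of a column with random signs.\<close>

lemma cosh_power_le_quarter:
  fixes a \<sigma> r m :: real and k :: nat
  assumes k: "0 < k" and \<sigma>: "0 < \<sigma>" and r: "1 \<le> r" "r \<le> m" and m: "16 \<le> m"
    and a: "a\<^sup>2 < 1/2 * \<sigma>\<^sup>2 * max (ln r) (sqrt (real k * ln r))"
  shows "cosh ((a / sqrt (real k))\<^sup>2 / \<sigma>\<^sup>2) ^ k \<le> m / 4"
proof -
  define v where "v = a\<^sup>2 / \<sigma>\<^sup>2"
  have v: "0 \<le> v" "v < 1/2 * max (ln r) (sqrt (real k * ln r))"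
    using a \<sigma> by (auto simp: v_def field_simps)
  have arg: "(a / sqrt (real k))\<^sup>2 / \<sigma>\<^sup>2 = v / k"
    using k by (simp add: v_def power_divide)
  \<comment> \<open>When \<open>ln r\<close> attains the maximum, the bound by
    \<open>exp \<bar>x\<bar>\<close> gives the exponent \<open>v\<close>. Otherwise the bound by
    \<open>exp (x\<^sup>2)\<close> gives \<open>v\<^sup>2 / k\<close>, and squaring removes the root
    in the threshold.\<close>
  have "cosh (v / k) ^ k \<le> exp (1/2 * ln r)"
  proof (cases "sqrt (real k * ln r) \<le> ln r")
    case True
    have "cosh (v / k) ^ k \<le> exp (v / k) ^ k"
      using cosh_le_exp_abs[of "v / k"] v by (intro power_mono) auto
    also have "\<dots> = exp v" using k by (simp flip: exp_of_nat_mult)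
    also have "\<dots> \<le> exp (1/2 * ln r)" using v True by simp
    finally show ?thesis .
  next
    case False
    have "cosh (v / k) ^ k \<le> exp ((v / k)\<^sup>2) ^ k"
      using cosh_le_exp_square[of "v / k"] by (intro power_mono) auto
    also have "\<dots> = exp (v\<^sup>2 / k)" using k
      by (simp add: power2_eq_square field_simps flip: exp_of_nat_mult)
    finally have 1: "cosh (v / k) ^ k \<le> exp (v\<^sup>2 / k)" .
    have "v\<^sup>2 \<le> (1/2 * sqrt (real k * ln r))\<^sup>2"
      using v False by (intro power_mono) auto
    also have "\<dots> = 1/4 * (k * ln r)" using r by (simp add: power_mult_distrib power2_eq_square)
    finally have "v\<^sup>2 / k \<le> 1/4 * ln r" using k by (simp add: field_simps)
    also have "\<dots> \<le> 1/2 * ln r" using r by simp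
    finally show ?thesis using 1 by (smt (verit) exp_le_cancel_iff)
  qed
  also have "exp (1/2 * ln r) = sqrt r"
    using r by (simp add: powr_half_sqrt[symmetric] powr_def)
  \<comment> \<open>In the Hamming bound \<open>r\<close> is the ratio \<open>(d - s) / s\<close>,
    while \<open>m\<close> is the integer block length \<open>d div s\<close>.\<close>
  also have "\<dots> \<le> sqrt m" using r by simp
  also have "\<dots> \<le> m / 4"
  proof -
    \<comment> \<open>The size 16 is what makes \<open>sqrt m\<close> at most
      \<open>m / 4\<close>.\<close>
    have "m * 16 \<le> m * m" using m by (intro mult_left_mono) auto
    then show ?thesis using m by (intro real_le_lsqrt) (auto simp: power2_eq_square)
  qed
  finally show ?thesis unfolding arg .
qed

section \<open>Gaussian likelihood ratios\<close>

definition gauss :: "real \<Rightarrow> real \<Rightarrow> real measure" where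
  "gauss t \<sigma> = density lborel (\<lambda>x. ennreal (normal_density t \<sigma> x))"

text \<open>The density of the normal law with mean \<open>t\<close> and standard deviation
  \<open>\<sigma>\<close> with respect to the centred one.\<close>

definition lr :: "real \<Rightarrow> real \<Rightarrow> real \<Rightarrow> real" where
  "lr \<sigma> t x = exp (t * x / \<sigma>\<^sup>2 - t\<^sup>2 / (2 * \<sigma>\<^sup>2))"

lemma borel_measurable_lr [measurable]: "lr \<sigma> t \<in> borel_measurable borel"
  unfolding lr_def by measurable

lemma lr_pos [simp]: "0 < lr \<sigma> t x" "0 \<le> lr \<sigma> t x"
  by (auto simp: lr_def)

lemma lr_0 [simp]: "lr \<sigma> 0 x = 1"
  by (simp add: lr_def)

lemma lr_mult_normal_density:
  "\<sigma> > 0 \<Longrightarrow> normal_density 0 \<sigma> x * lr \<sigma> t x = normal_density t \<sigma> x"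
  unfolding normal_density_def lr_def
  by (simp add: exp_add[symmetric] power2_eq_square field_simps)

text \<open>The factor \<open>lr \<sigma> (t + u)\<close> integrates to 1 under the centred law, so
  second moments of likelihood ratios can be read off from the constant in front.\<close>

lemma lr_mult_lr:
  "\<sigma> > 0 \<Longrightarrow> lr \<sigma> t x * lr \<sigma> u x = exp (t * u / \<sigma>\<^sup>2) * lr \<sigma> (t + u) x"
  unfolding lr_def
  by (simp add: exp_add[symmetric] power2_eq_square field_simps)

lemma prob_space_gauss: "\<sigma> > 0 \<Longrightarrow> prob_space (gauss t \<sigma>)"
  unfolding gauss_def by (rule prob_space_normal_density)

lemma sets_gauss [simp, measurable_cong]: "sets (gauss t \<sigma>) = sets borel"
  and space_gauss [simp]: "space (gauss t \<sigma>) = UNIV"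
  by (simp_all add: gauss_def)

lemma gauss_eq_density:
  assumes "\<sigma> > 0"
  shows "gauss t \<sigma> = density (gauss 0 \<sigma>) (\<lambda>x. ennreal (lr \<sigma> t x))"
  unfolding gauss_def
  by (subst density_density_eq)
     (auto simp: lr_mult_normal_density assms ennreal_mult[symmetric])

lemma nn_integral_lr:
  assumes "\<sigma> > 0"
  shows "(\<integral>\<^sup>+x. ennreal (lr \<sigma> t x) \<partial>gauss 0 \<sigma>) = 1"
proof -
  have "emeasure (gauss t \<sigma>) UNIV = 1"
    using prob_space.emeasure_space_1[OF prob_space_gauss[OF assms]] by simp
  then show ?thesis
    by (subst (asm) gauss_eq_density[OF assms]) (simp add: emeasure_density)
qed

lemma distr_std_normal:
  assumes "\<sigma> > 0"
  shows "distr (density lborel (\<lambda>x. ennreal (std_normal_density x))) borel (\<lambda>x. t + \<sigma> * x)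
    = gauss t \<sigma>"
proof -
  interpret prob_space "density lborel (\<lambda>x. ennreal (std_normal_density x))"
    by (rule prob_space_normal_density) simp
  have "distributed (density lborel (\<lambda>x. ennreal (std_normal_density x))) lborel (\<lambda>x. x) std_normal_density"
    by (auto simp: distributed_def distr_id2)
  from normal_density_affine[OF this, of \<sigma> t] assms
  have "distr (density lborel (\<lambda>x. ennreal (std_normal_density x))) lborel (\<lambda>x. t + \<sigma> * x)
    = gauss t \<sigma>"
    by (simp add: distributed_def gauss_def)
  \<comment> \<open>The target measure enters \<open>distr\<close> only through its measurable sets,
    which \<open>lborel\<close> and \<open>borel\<close> share.\<close>
  then show ?thesis by (metis distr_cong sets_lborel)
qed

section \<open>Laws of the whole matrix\<close>

text \<open>Pure noise, the common reference measure against which all likelihood ratios are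
  taken.\<close>

definition null_law :: "nat \<Rightarrow> nat \<Rightarrow> real \<Rightarrow> (nat \<times> nat \<Rightarrow> real) measure" where
  "null_law k d \<sigma> = (\<Pi>\<^sub>M _\<in>entries k d. gauss 0 \<sigma>)"

lemma sets_null_law [simp, measurable_cong]: "sets (null_law k d \<sigma>) = sets (matrix_space k d)"
  unfolding null_law_def by (intro sets_PiM_cong) auto

lemma space_null_law [simp]: "space (null_law k d \<sigma>) = entries k d \<rightarrow>\<^sub>E UNIV"
  unfolding null_law_def by (simp add: space_PiM)

lemma product_sigma_finite_gauss: "\<sigma> > 0 \<Longrightarrow> product_sigma_finite (\<lambda>p. gauss (t p) \<sigma>)"
  unfolding product_sigma_finite_def
  by (intro allI prob_space_imp_sigma_finite prob_space_gauss)

lemma nn_integral_null_law_prod: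
  assumes "\<sigma> > 0" "\<And>p. p \<in> entries k d \<Longrightarrow> f p \<in> borel_measurable borel"
  shows "(\<integral>\<^sup>+y. (\<Prod>p\<in>entries k d. f p (y p)) \<partial>null_law k d \<sigma>)
    = (\<Prod>p\<in>entries k d. \<integral>\<^sup>+x. f p x \<partial>gauss 0 \<sigma>)"
  using assms unfolding null_law_def
  by (intro product_sigma_finite.product_nn_integral_prod product_sigma_finite_gauss)
     (auto simp: measurable_cong_sets[OF sets_gauss refl])

text \<open>The model acts coordinate by coordinate, so the preimage of a box is a box, and a
  product law is determined by its values on boxes.\<close>

lemma obs_law_eq_PiM:
  assumes "\<sigma> > 0"
  shows "obs_law k d \<sigma> \<theta> = (\<Pi>\<^sub>M p\<in>entries k d. gauss (\<theta> p) \<sigma>)"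
proof -
  let ?N = "density lborel (\<lambda>x. ennreal (std_normal_density x))"
  let ?f = "\<lambda>\<xi>. \<lambda>p\<in>entries k d. \<theta> p + \<sigma> * \<xi> p"
  interpret N: product_sigma_finite "\<lambda>p::nat\<times>nat. ?N"
    unfolding product_sigma_finite_def
    by (intro allI prob_space_imp_sigma_finite prob_space_normal_density) simp
  interpret G: product_sigma_finite "\<lambda>p. gauss (\<theta> p) \<sigma>"
    by (rule product_sigma_finite_gauss[OF assms])
  have f [measurable]: "?f \<in> measurable (\<Pi>\<^sub>M p\<in>entries k d. ?N) (matrix_space k d)"
    by measurable
  show ?thesis
  proof (rule G.PiM_eqI)
    show "sets (obs_law k d \<sigma> \<theta>) = sets (Pi\<^sub>M (entries k d) (\<lambda>p. gauss (\<theta> p) \<sigma>))"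
      by (auto simp: obs_law_def intro!: sets_PiM_cong)
    fix A assume A: "\<And>p. p \<in> entries k d \<Longrightarrow> A p \<in> sets (gauss (\<theta> p) \<sigma>)"
    then have A': "A p \<in> sets borel" if "p \<in> entries k d" for p using that by simp
    have "emeasure (obs_law k d \<sigma> \<theta>) (Pi\<^sub>E (entries k d) A)
      = emeasure (\<Pi>\<^sub>M p\<in>entries k d. ?N) (?f -` (Pi\<^sub>E (entries k d) A) \<inter> space (\<Pi>\<^sub>M p\<in>entries k d. ?N))"
      unfolding obs_law_def noise_law_def using A'
      by (intro emeasure_distr f) (auto intro!: sets_PiM_I_finite)
    also have "?f -` (Pi\<^sub>E (entries k d) A) \<inter> space (\<Pi>\<^sub>M p\<in>entries k d. ?N)
      = Pi\<^sub>E (entries k d) (\<lambda>p. (\<lambda>x. \<theta> p + \<sigma> * x) -` A p)"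
      by (auto simp: space_PiM PiE_iff restrict_def extensional_def)
    also have "emeasure (\<Pi>\<^sub>M p\<in>entries k d. ?N) \<dots>
      = (\<Prod>p\<in>entries k d. emeasure ?N ((\<lambda>x. \<theta> p + \<sigma> * x) -` A p))"
      using A' by (intro N.emeasure_PiM) (auto intro!: measurable_sets_borel[where M = borel])
    also have "\<dots> = (\<Prod>p\<in>entries k d. emeasure (gauss (\<theta> p) \<sigma>) (A p))"
      using A' by (intro prod.cong refl) (simp add: distr_std_normal[OF assms, symmetric] emeasure_distr)
    finally show "emeasure (obs_law k d \<sigma> \<theta>) (Pi\<^sub>E (entries k d) A)
      = (\<Prod>p\<in>entries k d. emeasure (gauss (\<theta> p) \<sigma>) (A p))" .
  qed simp
qed

text \<open>The indicator of a box factors over the entries, so integrating the product density over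
  a box gives a product of one-dimensional Gaussian probabilities.\<close>

lemma obs_law_eq_density:
  assumes "\<sigma> > 0"
  shows "obs_law k d \<sigma> \<theta> =
    density (null_law k d \<sigma>) (\<lambda>y. \<Prod>p\<in>entries k d. ennreal (lr \<sigma> (\<theta> p) (y p)))"
proof -
  interpret G: product_sigma_finite "\<lambda>p. gauss (\<theta> p) \<sigma>"
    by (rule product_sigma_finite_gauss[OF assms])
  have "density (null_law k d \<sigma>) (\<lambda>y. \<Prod>p\<in>entries k d. ennreal (lr \<sigma> (\<theta> p) (y p)))
    = (\<Pi>\<^sub>M p\<in>entries k d. gauss (\<theta> p) \<sigma>)" (is "density _ ?D = _")
  proof (rule G.PiM_eqI)
    show "sets (density (null_law k d \<sigma>) ?D) = sets (Pi\<^sub>M (entries k d) (\<lambda>p. gauss (\<theta> p) \<sigma>))"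
      by (auto intro!: sets_PiM_cong)
    fix A assume A: "\<And>p. p \<in> entries k d \<Longrightarrow> A p \<in> sets (gauss (\<theta> p) \<sigma>)"
    then have A' [measurable]: "A p \<in> sets borel" if "p \<in> entries k d" for p using that by simp
    have "emeasure (density (null_law k d \<sigma>) ?D) (Pi\<^sub>E (entries k d) A)
      = (\<integral>\<^sup>+y. ?D y * indicator (Pi\<^sub>E (entries k d) A) y \<partial>null_law k d \<sigma>)"
      using A' by (intro emeasure_density) (auto intro!: sets_PiM_I_finite)
    also have "\<dots> = (\<integral>\<^sup>+y. (\<Prod>p\<in>entries k d. ennreal (lr \<sigma> (\<theta> p) (y p)) * indicator (A p) (y p))
      \<partial>null_law k d \<sigma>)"
    proof (rule nn_integral_cong)
      fix y assume y: "y \<in> space (null_law k d \<sigma>)"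
      have "indicator (Pi\<^sub>E (entries k d) A) y = (\<Prod>p\<in>entries k d. indicator (A p) (y p) :: ennreal)"
      proof (cases "y \<in> Pi\<^sub>E (entries k d) A")
        case True
        then have "y p \<in> A p" if "p \<in> entries k d" for p using that by (rule PiE_mem)
        then show ?thesis using True by simp
      next
        case False
        \<comment> \<open>As a point of the space, \<open>y\<close> is extensional, so it can leave
          the box only at an entry of the matrix.\<close>
        then obtain p where "p \<in> entries k d" "y p \<notin> A p" using y by (auto simp: PiE_iff)
        then have "(\<Prod>p\<in>entries k d. indicator (A p) (y p) :: ennreal) = 0"
          by (intro prod_zero bexI[of _ p]) auto
        then show ?thesis using False by simp
      qed
      then show "?D y * indicator (Pi\<^sub>E (entries k d) A) y
        = (\<Prod>p\<in>entries k d. ennreal (lr \<sigma> (\<theta> p) (y p)) * indicator (A p) (y p))"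
        by (simp add: prod.distrib)
    qed
    also have "\<dots> = (\<Prod>p\<in>entries k d. \<integral>\<^sup>+x. ennreal (lr \<sigma> (\<theta> p) x) * indicator (A p) x \<partial>gauss 0 \<sigma>)"
      by (rule nn_integral_null_law_prod[OF assms]) measurable
    also have "\<dots> = (\<Prod>p\<in>entries k d. emeasure (gauss (\<theta> p) \<sigma>) (A p))"
      by (intro prod.cong refl, subst (2) gauss_eq_density[OF assms])
         (simp add: emeasure_density)
    finally show "emeasure (density (null_law k d \<sigma>) ?D) (Pi\<^sub>E (entries k d) A)
      = (\<Prod>p\<in>entries k d. emeasure (gauss (\<theta> p) \<sigma>) (A p))" .
  qed simp
  then show ?thesis by (simp add: obs_law_eq_PiM[OF assms])
qed

declare One_nat_def [simp del]

section \<open>A single entry with a random sign\<close>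

text \<open>The likelihood ratio of the equal mixture of the means \<open>b\<close> and
  \<open>- b\<close>.\<close>

definition sym_lr :: "real \<Rightarrow> real \<Rightarrow> real \<Rightarrow> real" where
  "sym_lr \<sigma> b x = (lr \<sigma> b x + lr \<sigma> (- b) x) / 2"

lemma borel_measurable_sym_lr [measurable]: "sym_lr \<sigma> b \<in> borel_measurable borel"
  unfolding sym_lr_def by measurable

lemma sym_lr_nonneg [simp]: "0 \<le> sym_lr \<sigma> b x"
  by (simp add: sym_lr_def)

lemma ennreal_lincomb:
  "0 \<le> c \<Longrightarrow> 0 \<le> u \<Longrightarrow> 0 \<le> c' \<Longrightarrow> 0 \<le> u' \<Longrightarrow>
    ennreal (c * u + c' * u') = ennreal c * ennreal u + ennreal c' * ennreal u'"
  by (simp add: ennreal_mult)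

lemma ennreal_half_add_half: "ennreal (1/2) + ennreal (1/2) = 1"
  by (subst ennreal_plus[symmetric]) auto

lemma ennreal_sym_lr:
  "ennreal (sym_lr \<sigma> b x) = ennreal (1/2) * ennreal (lr \<sigma> b x) + ennreal (1/2) * ennreal (lr \<sigma> (- b) x)"
proof -
  have "sym_lr \<sigma> b x = 1/2 * lr \<sigma> b x + 1/2 * lr \<sigma> (- b) x" by (simp add: sym_lr_def)
  then show ?thesis by (simp only:) (rule ennreal_lincomb, auto)
qed

lemma nn_integral_sym_lr:
  assumes "\<sigma> > 0"
  shows "(\<integral>\<^sup>+x. ennreal (sym_lr \<sigma> b x) \<partial>gauss 0 \<sigma>) = 1"
proof -
  have "(\<integral>\<^sup>+x. ennreal (sym_lr \<sigma> b x) \<partial>gauss 0 \<sigma>)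
    = (\<integral>\<^sup>+x. ennreal (1/2) * ennreal (lr \<sigma> b x) + ennreal (1/2) * ennreal (lr \<sigma> (- b) x) \<partial>gauss 0 \<sigma>)"
    by (simp only: ennreal_sym_lr)
  also have "\<dots> = ennreal (1/2) + ennreal (1/2)"
    by (simp add: nn_integral_add nn_integral_cmult nn_integral_lr[OF assms])
  finally show ?thesis by (simp only: ennreal_half_add_half)
qed

text \<open>In the expanded square, equal signs produce the factor
  \<open>exp (b\<^sup>2 / \<sigma>\<^sup>2)\<close> and opposite signs its inverse, each with total
  weight one half.\<close>

lemma nn_integral_sym_lr_square:
  assumes "\<sigma> > 0"
  shows "(\<integral>\<^sup>+x. (ennreal (sym_lr \<sigma> b x))\<^sup>2 \<partial>gauss 0 \<sigma>) = ennreal (cosh (b\<^sup>2 / \<sigma>\<^sup>2))"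
proof -
  let ?p = "exp (b\<^sup>2 / \<sigma>\<^sup>2) / 4" and ?m = "exp (- (b\<^sup>2 / \<sigma>\<^sup>2)) / 2"
  have eq: "(sym_lr \<sigma> b x)\<^sup>2 = ?p * lr \<sigma> (2 * b) x + ?p * lr \<sigma> (- 2 * b) x + ?m" for x
  proof -
    have "(sym_lr \<sigma> b x)\<^sup>2 = (lr \<sigma> b x * lr \<sigma> b x + lr \<sigma> (- b) x * lr \<sigma> (- b) x
      + 2 * (lr \<sigma> b x * lr \<sigma> (- b) x)) / 4"
      unfolding sym_lr_def by (simp add: power2_eq_square algebra_simps)
    also have "\<dots> = ?p * lr \<sigma> (2 * b) x + ?p * lr \<sigma> (- 2 * b) x + ?m"
      unfolding lr_mult_lr[OF assms] by (simp add: power2_eq_square field_simps)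
    finally show ?thesis .
  qed
  have "(\<integral>\<^sup>+x. (ennreal (sym_lr \<sigma> b x))\<^sup>2 \<partial>gauss 0 \<sigma>)
    = (\<integral>\<^sup>+x. ennreal ?p * ennreal (lr \<sigma> (2 * b) x) + ennreal ?p * ennreal (lr \<sigma> (- 2 * b) x) + ennreal ?m \<partial>gauss 0 \<sigma>)"
    by (intro nn_integral_cong)
       (simp only: ennreal_power sym_lr_nonneg eq, subst ennreal_plus,
         auto intro!: ennreal_lincomb simp del: ennreal_plus times_divide_eq_left)
  also have "\<dots> = ennreal ?p + ennreal ?p + ennreal ?m"
    using prob_space.emeasure_space_1[OF prob_space_gauss[OF assms]]
    by (simp add: nn_integral_add nn_integral_cmult nn_integral_lr[OF assms])
  also have "\<dots> = ennreal (cosh (b\<^sup>2 / \<sigma>\<^sup>2))"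
    by (simp add: cosh_field_def ennreal_plus[symmetric] add_divide_distrib del: ennreal_plus)
  finally show ?thesis .
qed

section \<open>Mixtures over random signs\<close>

text \<open>The likelihood ratio, against pure noise, of the mixture over independent uniform signs of
  the matrices with entries \<open>\<plusminus>b\<close> in the columns \<open>J\<close> and \<open>0\<close> elsewhere.\<close>

definition mix_density :: "nat \<Rightarrow> nat \<Rightarrow> real \<Rightarrow> real \<Rightarrow> nat set \<Rightarrow> (nat \<times> nat \<Rightarrow> real) \<Rightarrow> ennreal" where
  "mix_density k d \<sigma> b J y =
     (\<Prod>p\<in>entries k d. if snd p \<in> J then ennreal (sym_lr \<sigma> b (y p)) else 1)"

definition mix_law :: "nat \<Rightarrow> nat \<Rightarrow> real \<Rightarrow> real \<Rightarrow> nat set \<Rightarrow> (nat \<times> nat \<Rightarrow> real) measure" where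
  "mix_law k d \<sigma> b J = density (null_law k d \<sigma>) (mix_density k d \<sigma> b J)"

lemma borel_measurable_mix_density [measurable]:
  "mix_density k d \<sigma> b J \<in> borel_measurable (matrix_space k d)"
  unfolding mix_density_def by measurable

lemma sets_mix_law [simp, measurable_cong]: "sets (mix_law k d \<sigma> b J) = sets (matrix_space k d)"
  and space_mix_law [simp]: "space (mix_law k d \<sigma> b J) = entries k d \<rightarrow>\<^sub>E UNIV"
  by (simp_all add: mix_law_def)

lemma prob_space_mix_law:
  assumes "\<sigma> > 0"
  shows "prob_space (mix_law k d \<sigma> b J)"
proof
  have "emeasure (mix_law k d \<sigma> b J) (space (mix_law k d \<sigma> b J))
    = (\<integral>\<^sup>+y. mix_density k d \<sigma> b J y \<partial>null_law k d \<sigma>)"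
    unfolding mix_law_def space_density
    by (subst emeasure_density, measurable) (auto intro!: nn_integral_cong simp del: space_null_law)
  also have "\<dots> = (\<Prod>p\<in>entries k d. \<integral>\<^sup>+x. (if snd p \<in> J then ennreal (sym_lr \<sigma> b x) else 1) \<partial>gauss 0 \<sigma>)"
    unfolding mix_density_def by (rule nn_integral_null_law_prod[OF assms]) measurable
  also have "\<dots> = 1"
    using prob_space.emeasure_space_1[OF prob_space_gauss[OF assms]]
    by (intro prod.neutral ballI, case_tac "snd x \<in> J") (simp_all add: nn_integral_sym_lr[OF assms])
  finally show "emeasure (mix_law k d \<sigma> b J) (space (mix_law k d \<sigma> b J)) = 1" .
qed

lemma nn_integral_mix_law:
  assumes [measurable]: "f \<in> borel_measurable (matrix_space k d)"
  shows "(\<integral>\<^sup>+y. f y \<partial>mix_law k d \<sigma> b J) = (\<integral>\<^sup>+y. mix_density k d \<sigma> b J y * f y \<partial>null_law k d \<sigma>)"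
  unfolding mix_law_def by (rule nn_integral_density) measurable

text \<open>The signs \<open>\<epsilon>\<close> are indexed by all entries, so that the sign space
  and its uniform weight are the same for every \<open>J\<close>.\<close>

definition signal :: "nat \<Rightarrow> nat \<Rightarrow> real \<Rightarrow> nat set \<Rightarrow> (nat \<times> nat \<Rightarrow> real) \<Rightarrow> nat \<times> nat \<Rightarrow> real" where
  "signal k d b J \<epsilon> = (\<lambda>p\<in>entries k d. if snd p \<in> J then \<epsilon> p * b else 0)"

text \<open>Multiplying out the two-point averages gives a sum over sign matrices. Outside
  \<open>J\<close> both signs give the ratio 1, and their weights add up to one.\<close>

lemma mix_density_eq_sum:
  assumes "\<sigma> > 0"
  shows "mix_density k d \<sigma> b J y = (\<Sum>\<epsilon>\<in>entries k d \<rightarrow>\<^sub>E {- 1, 1}.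
    ennreal (1/2) ^ card (entries k d) * (\<Prod>p\<in>entries k d. ennreal (lr \<sigma> (signal k d b J \<epsilon> p) (y p))))"
proof -
  let ?h = "\<lambda>p e. ennreal (1/2) * ennreal (lr \<sigma> (if snd p \<in> J then e * b else 0) (y p))"
  have "mix_density k d \<sigma> b J y = (\<Prod>p\<in>entries k d. \<Sum>e\<in>{- 1, 1 :: real}. ?h p e)"
    unfolding mix_density_def
  proof (intro prod.cong refl)
    fix p
    show "(if snd p \<in> J then ennreal (sym_lr \<sigma> b (y p)) else 1) = (\<Sum>e\<in>{- 1, 1 :: real}. ?h p e)"
      by (cases "snd p \<in> J") (use ennreal_half_add_half in \<open>simp_all add: ennreal_sym_lr add.commute del: sum_constant\<close>)
  qed
  also have "\<dots> = (\<Sum>\<epsilon>\<in>entries k d \<rightarrow>\<^sub>E {- 1, 1}. \<Prod>p\<in>entries k d. ?h p (\<epsilon> p))"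
    by (rule prod_sum_PiE) auto
  also have "\<dots> = (\<Sum>\<epsilon>\<in>entries k d \<rightarrow>\<^sub>E {- 1, 1}.
    ennreal (1/2) ^ card (entries k d) * (\<Prod>p\<in>entries k d. ennreal (lr \<sigma> (signal k d b J \<epsilon> p) (y p))))"
    by (intro sum.cong refl) (simp add: prod.distrib signal_def)
  finally show ?thesis .
qed

lemma nn_integral_obs_law:
  assumes "\<sigma> > 0" and [measurable]: "f \<in> borel_measurable (matrix_space k d)"
  shows "(\<integral>\<^sup>+y. f y \<partial>obs_law k d \<sigma> \<theta>)
    = (\<integral>\<^sup>+y. (\<Prod>p\<in>entries k d. ennreal (lr \<sigma> (\<theta> p) (y p))) * f y \<partial>null_law k d \<sigma>)"
  unfolding obs_law_eq_density[OF assms(1)]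
  by (rule nn_integral_density) measurable

text \<open>The mixture is an average of observation laws, so a bound uniform in the signs passes to
  it. This links the Bayes risk to the worst-case risk.\<close>

lemma nn_integral_mix_law_le:
  assumes \<sigma>: "\<sigma> > 0" and [measurable]: "f \<in> borel_measurable (matrix_space k d)"
    and le: "\<And>\<epsilon>. \<epsilon> \<in> entries k d \<rightarrow>\<^sub>E {- 1, 1} \<Longrightarrow> (\<integral>\<^sup>+y. f y \<partial>obs_law k d \<sigma> (signal k d b J \<epsilon>)) \<le> C"
  shows "(\<integral>\<^sup>+y. f y \<partial>mix_law k d \<sigma> b J) \<le> C"
proof -
  let ?E = "entries k d \<rightarrow>\<^sub>E {- 1, 1 :: real}" and ?w = "ennreal (1/2) ^ card (entries k d)"
  have "(\<integral>\<^sup>+y. f y \<partial>mix_law k d \<sigma> b J) = (\<integral>\<^sup>+y. (\<Sum>\<epsilon>\<in>?E.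
    ?w * ((\<Prod>p\<in>entries k d. ennreal (lr \<sigma> (signal k d b J \<epsilon> p) (y p))) * f y)) \<partial>null_law k d \<sigma>)"
    by (simp add: nn_integral_mix_law mix_density_eq_sum[OF \<sigma>] sum_distrib_right mult.assoc)
  also have "\<dots> = (\<Sum>\<epsilon>\<in>?E. ?w * (\<integral>\<^sup>+y. f y \<partial>obs_law k d \<sigma> (signal k d b J \<epsilon>)))"
    by (simp add: nn_integral_sum nn_integral_cmult nn_integral_obs_law[OF \<sigma>])
  also have "\<dots> \<le> (\<Sum>\<epsilon>\<in>?E. ?w * C)"
    by (intro sum_mono mult_left_mono le) auto
  also have "\<dots> = of_nat (2 ^ card (entries k d)) * ?w * C"
    by (simp add: card_PiE numeral_2_eq_2 mult.assoc)
  also have "of_nat (2 ^ card (entries k d)) * ?w = 1"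
    using ennreal_half_add_half by (simp add: mult_2[symmetric] flip: power_mult_distrib)
  finally show ?thesis by simp
qed

section \<open>The second moment method\<close>

text \<open>This is the change of measure from an added column \<open>j\<close> to the columns
  \<open>K\<close> alone: the integrand gains the likelihood ratio of column \<open>j\<close> as a
  factor.\<close>

lemma mix_density_insert:
  assumes "j \<notin> K"
  shows "mix_density k d \<sigma> b (insert j K) y = mix_density k d \<sigma> b K y * mix_density k d \<sigma> b {j} y"
  unfolding mix_density_def prod.distrib[symmetric] using assms by (intro prod.cong) auto

text \<open>Since \<open>j\<close> is outside \<open>K\<close>, the squared ratio and the density of
  the mixture involve different entries. Each of the \<open>k\<close> entries of column
  \<open>j\<close> contributes its second moment, every other entry contributes 1.\<close>

lemma nn_integral_mix_density_square:
  assumes \<sigma>: "\<sigma> > 0" and j: "j \<in> {1..d}" "j \<notin> K"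
  shows "(\<integral>\<^sup>+y. (mix_density k d \<sigma> b {j} y)\<^sup>2 \<partial>mix_law k d \<sigma> b K)
    = ennreal (cosh (b\<^sup>2 / \<sigma>\<^sup>2) ^ k)"
proof -
  let ?h = "\<lambda>p x. if snd p \<in> K then ennreal (sym_lr \<sigma> b x)
    else if snd p = j then (ennreal (sym_lr \<sigma> b x))\<^sup>2 else 1"
  have "(\<integral>\<^sup>+y. (mix_density k d \<sigma> b {j} y)\<^sup>2 \<partial>mix_law k d \<sigma> b K)
    = (\<integral>\<^sup>+y. (\<Prod>p\<in>entries k d. ?h p (y p)) \<partial>null_law k d \<sigma>)"
    using j(2) by (subst nn_integral_mix_law, measurable)
      (auto intro!: nn_integral_cong prod.cong
         simp: mix_density_def prod_power_distrib prod.distrib[symmetric])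
  also have "\<dots> = (\<Prod>p\<in>entries k d. \<integral>\<^sup>+x. ?h p x \<partial>gauss 0 \<sigma>)"
    by (rule nn_integral_null_law_prod[OF \<sigma>]) measurable
  also have "\<dots> = (\<Prod>p\<in>entries k d. if snd p = j then ennreal (cosh (b\<^sup>2 / \<sigma>\<^sup>2)) else 1)"
    using j(2) prob_space.emeasure_space_1[OF prob_space_gauss[OF \<sigma>]]
    by (intro prod.cong refl, case_tac "snd x \<in> K"; case_tac "snd x = j")
       (simp_all add: nn_integral_sym_lr[OF \<sigma>] nn_integral_sym_lr_square[OF \<sigma>])
  \<comment> \<open>Taken row by row, each row holds exactly one entry of column
    \<open>j\<close>.\<close>
  also have "\<dots> = (\<Prod>i\<in>{1..k}. \<Prod>j'\<in>{1..d}. if j' = j then ennreal (cosh (b\<^sup>2 / \<sigma>\<^sup>2)) else 1)"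
    by (subst prod.cartesian_product) (simp add: case_prod_beta)
  also have "\<dots> = ennreal (cosh (b\<^sup>2 / \<sigma>\<^sup>2)) ^ k"
    using j(1) by (simp add: prod.delta)
  finally show ?thesis by (simp add: ennreal_power)
qed

text \<open>By a weighted AM-GM inequality, the likelihood ratio \<open>L\<close> of each hypothesis against the
  absence of a signal in \<open>B\<close> satisfies \<open>L \<phi> \<le> m \<phi> / 4 + L\<^sup>2 / m\<close> with \<open>m = card B\<close>.\<close>

lemma sum_detection_le_half:
  fixes \<phi> :: "nat \<Rightarrow> (nat \<times> nat \<Rightarrow> real) \<Rightarrow> ennreal"
  assumes \<sigma>: "\<sigma> > 0" and B: "B \<subseteq> {1..d}" "B \<inter> K = {}"
    and [measurable]: "\<And>j. j \<in> B \<Longrightarrow> \<phi> j \<in> borel_measurable (matrix_space k d)"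
    and sum_le: "\<And>y. y \<in> space (matrix_space k d) \<Longrightarrow> (\<Sum>j\<in>B. \<phi> j y) \<le> 1"
    and X: "cosh (b\<^sup>2 / \<sigma>\<^sup>2) ^ k \<le> real (card B) / 4"
  shows "(\<Sum>j\<in>B. \<integral>\<^sup>+y. \<phi> j y \<partial>mix_law k d \<sigma> b (insert j K)) \<le> ennreal (real (card B) / 2)"
proof -
  let ?D = "\<lambda>j. mix_density k d \<sigma> b {j}"
  define m where "m = real (card B)"
  have fin: "finite B" using B(1) by (rule finite_subset) simp
  \<comment> \<open>Positivity of the second moment forces \<open>B\<close> to be nonempty, which
    allows division by \<open>m\<close>.\<close>
  have "0 < cosh (b\<^sup>2 / \<sigma>\<^sup>2) ^ k" by simp
  then have m: "0 < m" using X unfolding m_def by linarith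
  interpret K: prob_space "mix_law k d \<sigma> b K" by (rule prob_space_mix_law[OF \<sigma>])
  have amgm: "?D j y * \<phi> j y \<le> ennreal (m / 4) * \<phi> j y + ennreal (1 / m) * (?D j y)\<^sup>2"
    if j: "j \<in> B" and y: "y \<in> space (matrix_space k d)" for j y
  proof -
    have "\<phi> j y \<le> 1"
      using member_le_sum[OF j _ fin, of "\<lambda>j. \<phi> j y"] sum_le[OF y] by simp
    then obtain u where u: "\<phi> j y = ennreal u" "0 \<le> u" "u \<le> 1"
      by (cases "\<phi> j y") (auto simp: top_unique)
    define L where "L = (\<Prod>p\<in>entries k d. if snd p \<in> {j} then sym_lr \<sigma> b (y p) else 1)"
    have L: "?D j y = ennreal L" "0 \<le> L"
      unfolding mix_density_def L_def
      by (subst prod_ennreal[symmetric]) (auto intro!: prod.cong prod_nonneg)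
    \<comment> \<open>The weight \<open>m / 2\<close> balances the two terms, which contribute
      \<open>m / 4\<close> each in the end. Since \<open>u \<le> 1\<close>, the square of
      \<open>u\<close> can be replaced by \<open>u\<close>, so that \<open>\<phi>\<close> enters
      linearly.\<close>
    have "0 \<le> (m * u / 2 - L)\<^sup>2" by simp
    then have "L * u * m \<le> m\<^sup>2 * u\<^sup>2 / 4 + L\<^sup>2"
      by (simp add: power2_eq_square algebra_simps)
    also have "u\<^sup>2 \<le> u" using u by (simp add: power2_eq_square mult_left_le)
    then have "m\<^sup>2 * u\<^sup>2 / 4 + L\<^sup>2 \<le> m\<^sup>2 * u / 4 + L\<^sup>2"
      by (intro add_right_mono divide_right_mono mult_left_mono) auto
    finally have "L * u \<le> m / 4 * u + 1 / m * L\<^sup>2"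
      using m by (simp add: field_simps power2_eq_square)
    then show ?thesis using u L m
      by (simp add: ennreal_mult[symmetric] ennreal_power ennreal_plus[symmetric] ennreal_leI del: ennreal_plus)
  qed
  \<comment> \<open>All terms are moved to the same law, without a signal in \<open>B\<close>; there
    the pointwise bound on the sum of the \<open>\<phi> j\<close> applies.\<close>
  have "(\<Sum>j\<in>B. \<integral>\<^sup>+y. \<phi> j y \<partial>mix_law k d \<sigma> b (insert j K))
    = (\<Sum>j\<in>B. \<integral>\<^sup>+y. ?D j y * \<phi> j y \<partial>mix_law k d \<sigma> b K)"
  proof (intro sum.cong refl)
    fix j assume j: "j \<in> B"
    then have [measurable]: "\<phi> j \<in> borel_measurable (matrix_space k d)" and "j \<notin> K"
      using B by auto
    then show "(\<integral>\<^sup>+y. \<phi> j y \<partial>mix_law k d \<sigma> b (insert j K)) = (\<integral>\<^sup>+y. ?D j y * \<phi> j y \<partial>mix_law k d \<sigma> b K)"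
      by (simp add: nn_integral_mix_law mix_density_insert[OF \<open>j \<notin> K\<close>] mult.assoc)
  qed
  also have "\<dots> \<le> (\<Sum>j\<in>B. \<integral>\<^sup>+y. ennreal (m / 4) * \<phi> j y + ennreal (1 / m) * (?D j y)\<^sup>2 \<partial>mix_law k d \<sigma> b K)"
    using amgm by (intro sum_mono nn_integral_mono) (simp add: space_PiM)
  also have "\<dots> = (\<Sum>j\<in>B. ennreal (m / 4) * (\<integral>\<^sup>+y. \<phi> j y \<partial>mix_law k d \<sigma> b K)
    + ennreal (1 / m) * ennreal (cosh (b\<^sup>2 / \<sigma>\<^sup>2) ^ k))"
  proof (intro sum.cong refl)
    fix j assume j: "j \<in> B"
    then have [measurable]: "\<phi> j \<in> borel_measurable (matrix_space k d)" and "j \<notin> K" "j \<in> {1..d}"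
      using B by auto
    then show "(\<integral>\<^sup>+y. ennreal (m / 4) * \<phi> j y + ennreal (1 / m) * (?D j y)\<^sup>2 \<partial>mix_law k d \<sigma> b K)
      = ennreal (m / 4) * (\<integral>\<^sup>+y. \<phi> j y \<partial>mix_law k d \<sigma> b K)
        + ennreal (1 / m) * ennreal (cosh (b\<^sup>2 / \<sigma>\<^sup>2) ^ k)"
      by (simp add: nn_integral_add nn_integral_cmult nn_integral_mix_density_square[OF \<sigma>])
  qed
  also have "\<dots> = ennreal (m / 4) * (\<integral>\<^sup>+y. (\<Sum>j\<in>B. \<phi> j y) \<partial>mix_law k d \<sigma> b K)
    + of_nat (card B) * (ennreal (1 / m) * ennreal (cosh (b\<^sup>2 / \<sigma>\<^sup>2) ^ k))"
    by (simp add: sum.distrib sum_distrib_left nn_integral_sum)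
  also have "\<dots> \<le> ennreal (m / 4) * 1
    + of_nat (card B) * (ennreal (1 / m) * ennreal (m / 4))"
  proof (intro add_mono mult_left_mono)
    have "(\<integral>\<^sup>+y. (\<Sum>j\<in>B. \<phi> j y) \<partial>mix_law k d \<sigma> b K) \<le> (\<integral>\<^sup>+y. 1 \<partial>mix_law k d \<sigma> b K)"
      using sum_le by (intro nn_integral_mono) (simp add: space_PiM)
    then show "(\<integral>\<^sup>+y. (\<Sum>j\<in>B. \<phi> j y) \<partial>mix_law k d \<sigma> b K) \<le> 1"
      using K.emeasure_space_1 by simp
    show "ennreal (cosh (b\<^sup>2 / \<sigma>\<^sup>2) ^ k) \<le> ennreal (m / 4)"
      using X unfolding m_def by (rule ennreal_leI)
  qed auto
  also have "\<dots> = ennreal (m / 2)"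
    using m by (simp add: ennreal_of_nat_eq_real_of_nat m_def ennreal_mult[symmetric] ennreal_plus[symmetric] del: ennreal_plus)
  finally show ?thesis unfolding m_def .
qed

text \<open>Under each hypothesis detection and error add up to one, hence to \<open>card B\<close>
  in total, of which detections take at most half.\<close>

lemma sum_error_ge_half:
  fixes \<phi> \<psi> :: "nat \<Rightarrow> (nat \<times> nat \<Rightarrow> real) \<Rightarrow> ennreal"
  assumes \<sigma>: "\<sigma> > 0" and B: "B \<subseteq> {1..d}" "B \<inter> K = {}"
    and meas [measurable]: "\<And>j. j \<in> B \<Longrightarrow> \<phi> j \<in> borel_measurable (matrix_space k d)"
      "\<And>j. j \<in> B \<Longrightarrow> \<psi> j \<in> borel_measurable (matrix_space k d)"
    and sum_le: "\<And>y. y \<in> space (matrix_space k d) \<Longrightarrow> (\<Sum>j\<in>B. \<phi> j y) \<le> 1"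
    and add_eq: "\<And>j y. j \<in> B \<Longrightarrow> y \<in> space (matrix_space k d) \<Longrightarrow> \<phi> j y + \<psi> j y = 1"
    and X: "cosh (b\<^sup>2 / \<sigma>\<^sup>2) ^ k \<le> real (card B) / 4"
  shows "(\<Sum>j\<in>B. \<integral>\<^sup>+y. \<psi> j y \<partial>mix_law k d \<sigma> b (insert j K)) \<ge> ennreal (real (card B) / 2)"
proof -
  let ?I = "\<lambda>f. \<Sum>j\<in>B. \<integral>\<^sup>+y. f j y \<partial>mix_law k d \<sigma> b (insert j K)"
  have "?I \<phi> + ?I \<psi> = (\<Sum>j\<in>B. 1)"
    unfolding sum.distrib[symmetric]
  proof (intro sum.cong refl)
    fix j assume j: "j \<in> B"
    interpret prob_space "mix_law k d \<sigma> b (insert j K)" by (rule prob_space_mix_law[OF \<sigma>])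
    have "(\<integral>\<^sup>+y. \<phi> j y \<partial>mix_law k d \<sigma> b (insert j K)) + (\<integral>\<^sup>+y. \<psi> j y \<partial>mix_law k d \<sigma> b (insert j K))
      = (\<integral>\<^sup>+y. \<phi> j y + \<psi> j y \<partial>mix_law k d \<sigma> b (insert j K))"
      using meas[OF j] by (simp add: nn_integral_add)
    also have "\<dots> = (\<integral>\<^sup>+y. 1 \<partial>mix_law k d \<sigma> b (insert j K))"
      using add_eq[OF j] by (intro nn_integral_cong) (simp add: space_PiM)
    finally show "(\<integral>\<^sup>+y. \<phi> j y \<partial>mix_law k d \<sigma> b (insert j K))
      + (\<integral>\<^sup>+y. \<psi> j y \<partial>mix_law k d \<sigma> b (insert j K)) = 1"
      using emeasure_space_1 by simp
  qed
  also have "\<dots> = ennreal (real (card B) / 2) + ennreal (real (card B) / 2)"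
    by (simp add: ennreal_of_nat_eq_real_of_nat ennreal_plus[symmetric] del: ennreal_plus)
  finally have eq: "?I \<phi> + ?I \<psi> = ennreal (real (card B) / 2) + ennreal (real (card B) / 2)" .
  have le: "?I \<phi> \<le> ennreal (real (card B) / 2)"
    by (rule sum_detection_le_half[OF \<sigma> B meas(1) sum_le X])
  then have "ennreal (real (card B) / 2) + ennreal (real (card B) / 2) \<le> ennreal (real (card B) / 2) + ?I \<psi>"
    unfolding eq[symmetric] by (intro add_right_mono)
  \<comment> \<open>Cancellation is legitimate because the common term is finite.\<close>
  then show ?thesis by (simp add: ennreal_add_left_cancel_le)
qed

section \<open>Random-sign signals in the parameter class\<close>

text \<open>Each of the \<open>k\<close> entries has square \<open>a\<^sup>2 / k\<close> whatever
  its sign, so active columns sit exactly on the boundary of the class.\<close>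

lemma column_norm_signal:
  assumes "0 < k" "0 < a" "\<epsilon> \<in> entries k d \<rightarrow>\<^sub>E {- 1, 1}" "j \<in> J" "j \<in> {1..d}"
  shows "column_norm k (signal k d (a / sqrt (real k)) J \<epsilon>) j = a"
proof -
  have "(signal k d (a / sqrt (real k)) J \<epsilon> (i, j))\<^sup>2 = a\<^sup>2 / k" if "i \<in> {1..k}" for i
  proof -
    have "\<epsilon> (i, j) \<in> {- 1, 1}" using PiE_mem[OF assms(3), of "(i, j)"] assms(5) that by simp
    then have "(\<epsilon> (i, j))\<^sup>2 = 1" by auto
    then show ?thesis using that assms by (simp add: signal_def power_mult_distrib power_divide)
  qed
  then show ?thesis using assms by (simp add: column_norm_def L2_set_def)
qed

lemma column_zero_signal_iff:
  assumes "0 < k" "0 < a" "\<epsilon> \<in> entries k d \<rightarrow>\<^sub>E {- 1, 1}" "j \<in> {1..d}"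
  shows "column_zero k (signal k d (a / sqrt (real k)) J \<epsilon>) j \<longleftrightarrow> j \<notin> J"
proof
  assume *: "column_zero k (signal k d (a / sqrt (real k)) J \<epsilon>) j"
  show "j \<notin> J"
  proof
    assume "j \<in> J"
    from column_norm_signal[OF assms(1-3) this assms(4)] * assms(2) show False
      by (simp add: column_norm_def column_zero_def L2_set_def)
  qed
next
  assume "j \<notin> J"
  then show "column_zero k (signal k d (a / sqrt (real k)) J \<epsilon>) j"
    using assms(4) by (simp add: column_zero_def signal_def)
qed

lemma signal_in_Theta:
  assumes "0 < k" "0 < a" "\<epsilon> \<in> entries k d \<rightarrow>\<^sub>E {- 1, 1}" "J \<subseteq> {1..d}" "card J = s"
  shows "signal k d (a / sqrt (real k)) J \<epsilon> \<in> Theta k d s a"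
  unfolding Theta_def
proof (intro CollectI conjI exI[of _ J] ballI assms)
  show "signal k d (a / sqrt (real k)) J \<epsilon> \<in> entries k d \<rightarrow>\<^sub>E UNIV"
    by (auto simp: signal_def)
  show "a \<le> column_norm k (signal k d (a / sqrt (real k)) J \<epsilon>) j" if "j \<in> J" for j
    using column_norm_signal[OF assms(1-3) that] assms(4) that by auto
  show "column_zero k (signal k d (a / sqrt (real k)) J \<epsilon>) j" if "j \<in> {1..d} - J" for j
    using column_zero_signal_iff[OF assms(1-3), of j] that by auto
qed

text \<open>All sign choices with active set \<open>J\<close> lie in the class and share one pattern
  \<open>eta\<close>, so a loss \<open>f\<close> built for that pattern fits them all. The mixture
  average is then at most the worst risk.\<close>

lemma mix_law_le_SUP:
  assumes "0 < k" "0 < a" "\<sigma> > 0" "J \<subseteq> {1..d}" "card J = s"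
    and f: "f \<in> borel_measurable (matrix_space k d)"
    and R: "\<And>\<theta>. \<theta> \<in> Theta k d s a \<Longrightarrow> eta k d \<theta> = (\<lambda>j\<in>{1..d}. of_bool (j \<in> J)) \<Longrightarrow>
      (\<integral>\<^sup>+y. f y \<partial>obs_law k d \<sigma> \<theta>) \<le> R \<theta>"
  shows "(\<integral>\<^sup>+y. f y \<partial>mix_law k d \<sigma> (a / sqrt (real k)) J) \<le> (SUP \<theta>\<in>Theta k d s a. R \<theta>)"
proof (rule nn_integral_mix_law_le[OF \<open>\<sigma> > 0\<close> f])
  fix \<epsilon> :: "nat \<times> nat \<Rightarrow> real" assume \<epsilon>: "\<epsilon> \<in> entries k d \<rightarrow>\<^sub>E {- 1, 1}"
  let ?\<theta> = "signal k d (a / sqrt (real k)) J \<epsilon>"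
  have \<theta>: "?\<theta> \<in> Theta k d s a"
    by (rule signal_in_Theta[OF assms(1,2) \<epsilon> assms(4,5)])
  have "eta k d ?\<theta> = (\<lambda>j\<in>{1..d}. of_bool (j \<in> J))"
    unfolding eta_def using column_zero_signal_iff[OF assms(1,2) \<epsilon>] by (intro restrict_ext) simp
  then have "(\<integral>\<^sup>+y. f y \<partial>obs_law k d \<sigma> ?\<theta>) \<le> R ?\<theta>" by (rule R[OF \<theta>])
  also have "\<dots> \<le> (SUP \<theta>\<in>Theta k d s a. R \<theta>)" using \<theta> by (rule SUP_upper)
  finally show "(\<integral>\<^sup>+y. f y \<partial>obs_law k d \<sigma> ?\<theta>) \<le> (SUP \<theta>\<in>Theta k d s a. R \<theta>)" .
qed

lemma sets_obs_law [simp, measurable_cong]: "sets (obs_law k d \<sigma> \<theta>) = sets (matrix_space k d)"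
  by (simp add: obs_law_def)

section \<open>Risks of randomized selectors\<close>

locale randomized_selector =
  fixes k d :: nat and \<nu> :: "real measure" and T :: "(nat \<times> nat \<Rightarrow> real) \<times> real \<Rightarrow> nat \<Rightarrow> nat"
  assumes selector: "(\<nu>, T) \<in> selectors k d"
begin

lemma sets_\<nu> [simp, measurable_cong]: "sets \<nu> = sets borel"
  and T [measurable]: "T \<in> measurable (matrix_space k d \<Otimes>\<^sub>M borel) (count_space ({1..d} \<rightarrow>\<^sub>E {0, 1}))"
  and prob_\<nu>: "prob_space \<nu>"
  using selector by (auto simp: selectors_def)

sublocale prob_space \<nu> by (rule prob_\<nu>)

text \<open>The selector takes values in a discrete space, on which every loss is
  measurable.\<close>

lemma measurable_loss [measurable]:
  "(\<lambda>\<omega>. G (T \<omega>)) \<in> borel_measurable (matrix_space k d \<Otimes>\<^sub>M borel)" for G :: "_ \<Rightarrow> ennreal"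
  using T by (rule measurable_compose) simp

text \<open>Integrating out the randomization leaves a function of the observation alone, so a
  randomized selector can be treated as a fractional test.\<close>

definition avg :: "((nat \<Rightarrow> nat) \<Rightarrow> ennreal) \<Rightarrow> (nat \<times> nat \<Rightarrow> real) \<Rightarrow> ennreal" where
  "avg G y = (\<integral>\<^sup>+u. G (T (y, u)) \<partial>\<nu>)"

lemma measurable_section:
  assumes y: "y \<in> space (matrix_space k d)"
  shows "(\<lambda>u. G (T (y, u)) :: ennreal) \<in> borel_measurable \<nu>"
proof -
  have "(\<lambda>u. (y, u)) \<in> measurable \<nu> (matrix_space k d \<Otimes>\<^sub>M borel)"
    using y by measurable
  from measurable_compose[OF this measurable_loss[of G]] show ?thesis .
qed

lemma borel_measurable_avg [measurable]: "avg G \<in> borel_measurable (matrix_space k d)"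
proof -
  have "(\<lambda>\<omega>. G (T \<omega>)) \<in> borel_measurable (matrix_space k d \<Otimes>\<^sub>M \<nu>)" by measurable
  from borel_measurable_nn_integral_fst[OF this] show ?thesis by (simp add: avg_def[abs_def])
qed

lemma nn_integral_joint_law:
  "(\<integral>\<^sup>+\<omega>. G (T \<omega>) \<partial>joint_law k d \<sigma> \<theta> \<nu>) = (\<integral>\<^sup>+y. avg G y \<partial>obs_law k d \<sigma> \<theta>)"
  unfolding joint_law_def avg_def by (rule nn_integral_fst[symmetric]) measurable

lemma avg_1: "avg (\<lambda>_. 1) y = 1"
  using emeasure_space_1 by (simp add: avg_def)

lemma avg_mono: "(\<And>e. G e \<le> H e) \<Longrightarrow> avg G y \<le> avg H y"
  unfolding avg_def by (intro nn_integral_mono)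

lemma avg_add:
  "y \<in> space (matrix_space k d) \<Longrightarrow> avg (\<lambda>e. G e + H e) y = avg G y + avg H y"
  unfolding avg_def by (intro nn_integral_add measurable_section)

lemma avg_sum:
  "y \<in> space (matrix_space k d) \<Longrightarrow> avg (\<lambda>e. \<Sum>i\<in>I. G i e) y = (\<Sum>i\<in>I. avg (G i) y)"
  unfolding avg_def by (intro nn_integral_sum measurable_section)

lemma support_error_eq:
  "support_error k d \<sigma> (\<nu>, T) \<theta>
    = (\<integral>\<^sup>+y. avg (\<lambda>e. of_bool (supp d e \<noteq> supp d (eta k d \<theta>))) y \<partial>obs_law k d \<sigma> \<theta>)"
proof -
  let ?M = "joint_law k d \<sigma> \<theta> \<nu>" and ?G = "\<lambda>e. of_bool (supp d e \<noteq> supp d (eta k d \<theta>)) :: ennreal"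
  let ?A = "{\<omega> \<in> space ?M. supp d (T \<omega>) \<noteq> supp d (eta k d \<theta>)}"
  have [measurable]: "(\<lambda>\<omega>. ?G (T \<omega>)) \<in> borel_measurable ?M"
    unfolding joint_law_def by measurable
  \<comment> \<open>Written as a level set of a measurable loss, the error event is
    measurable.\<close>
  have "?A = (\<lambda>\<omega>. ?G (T \<omega>)) -` {1} \<inter> space ?M" by auto
  also have "\<dots> \<in> sets ?M" by measurable
  finally have "emeasure ?M ?A = (\<integral>\<^sup>+\<omega>. indicator ?A \<omega> \<partial>?M)" by simp
  also have "\<dots> = (\<integral>\<^sup>+\<omega>. ?G (T \<omega>) \<partial>?M)"
    by (intro nn_integral_cong) simp
  also have "\<dots> = (\<integral>\<^sup>+y. avg ?G y \<partial>obs_law k d \<sigma> \<theta>)"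
    by (rule nn_integral_joint_law)
  finally show ?thesis by (simp add: support_error_def)
qed

lemma hamming_risk_eq:
  "hamming_risk k d \<sigma> (\<nu>, T) \<theta>
    = (\<integral>\<^sup>+y. avg (\<lambda>e. of_nat (hamming d e (eta k d \<theta>))) y \<partial>obs_law k d \<sigma> \<theta>)"
  unfolding hamming_risk_def prod.case by (rule nn_integral_joint_law)

text \<open>Unequal supports force at least one differing coordinate.\<close>

lemma support_error_le_hamming_risk:
  "support_error k d \<sigma> (\<nu>, T) \<theta> \<le> hamming_risk k d \<sigma> (\<nu>, T) \<theta>"
  unfolding support_error_eq hamming_risk_eq
proof (intro nn_integral_mono avg_mono)
  fix e
  show "of_bool (supp d e \<noteq> supp d (eta k d \<theta>)) \<le> (of_nat (hamming d e (eta k d \<theta>)) :: ennreal)"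
  proof (cases "supp d e = supp d (eta k d \<theta>)")
    case False
    then obtain j where "j \<in> {1..d}" "e j \<noteq> eta k d \<theta> j" unfolding supp_def by fastforce
    then have "hamming d e (eta k d \<theta>) \<noteq> 0" unfolding hamming_def by auto
    then have "1 \<le> hamming d e (eta k d \<theta>)" by simp
    then have "(1 :: ennreal) \<le> of_nat (hamming d e (eta k d \<theta>))"
      by (metis of_nat_1 of_nat_le_iff of_nat_mono)
    then show ?thesis using False by simp
  qed simp
qed

text \<open>\<open>Q j e\<close> means that the decision \<open>e\<close> points to position
  \<open>j\<close>. Exclusive events have indicators summing to at most 1, which survives averaging
  over the randomization.\<close>

lemma sum_avg_error_ge_half:
  assumes "\<sigma> > 0" "B \<subseteq> {1..d}" "B \<inter> K = {}"
    and disjoint: "\<And>i j e. i \<in> B \<Longrightarrow> j \<in> B \<Longrightarrow> Q i e \<Longrightarrow> Q j e \<Longrightarrow> i = j"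
    and "cosh (b\<^sup>2 / \<sigma>\<^sup>2) ^ k \<le> real (card B) / 4"
  shows "(\<Sum>j\<in>B. \<integral>\<^sup>+y. avg (\<lambda>e. of_bool (\<not> Q j e)) y \<partial>mix_law k d \<sigma> b (insert j K))
    \<ge> ennreal (real (card B) / 2)"
proof (rule sum_error_ge_half[where \<phi> = "\<lambda>j. avg (\<lambda>e. of_bool (Q j e))"])
  fix y assume y: "y \<in> space (matrix_space k d)"
  have fin: "finite B" using assms(2) by (rule finite_subset) simp
  have "(\<Sum>j\<in>B. of_bool (Q j e)) \<le> (1 :: ennreal)" for e
  proof (cases "\<exists>i\<in>B. Q i e")
    case True
    then obtain i where i: "i \<in> B" "Q i e" by blast
    have "(\<Sum>j\<in>B. of_bool (Q j e)) = (\<Sum>j\<in>B. if j = i then 1 else 0 :: ennreal)"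
      using disjoint i by (intro sum.cong refl) (auto simp: of_bool_def)
    then show ?thesis using fin i by simp
  qed simp
  then have "avg (\<lambda>e. \<Sum>j\<in>B. of_bool (Q j e)) y \<le> avg (\<lambda>_. 1) y" by (rule avg_mono)
  then show "(\<Sum>j\<in>B. avg (\<lambda>e. of_bool (Q j e)) y) \<le> 1"
    by (simp add: avg_sum[OF y] avg_1)
  fix j assume "j \<in> B"
  have "(\<lambda>e. of_bool (Q j e) + of_bool (\<not> Q j e) :: ennreal) = (\<lambda>_. 1)" by auto
  then have "avg (\<lambda>e. of_bool (Q j e) + of_bool (\<not> Q j e)) y = 1"
    by (simp only: avg_1)
  then show "avg (\<lambda>e. of_bool (Q j e)) y + avg (\<lambda>e. of_bool (\<not> Q j e)) y = 1"
    by (simp only: avg_add[OF y])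
qed (use assms in simp_all)

lemma SUP_support_error_ge_half:
  assumes "0 < k" "0 < a" "\<sigma> > 0" "0 < s" "s < d"
    and X: "cosh ((a / sqrt (real k))\<^sup>2 / \<sigma>\<^sup>2) ^ k \<le> (real d - real s) / 4"
  shows "(SUP \<theta>\<in>Theta k d s a. support_error k d \<sigma> (\<nu>, T) \<theta>) \<ge> ennreal (1/2)" (is "?S \<ge> _")
proof -
  define K B where "K = {1..<s}" and "B = {s..d}"
  \<comment> \<open>Success means recovering the whole support; as \<open>B\<close> avoids
    \<open>K\<close>, one decision can succeed for at most one \<open>j\<close>.\<close>
  let ?Q = "\<lambda>j e. supp d e = insert j K"
  have B: "B \<subseteq> {1..d}" "B \<inter> K = {}" "card B = d - s + 1"
    using assms by (auto simp: B_def K_def)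
  have "ennreal (real (card B) / 2) \<le>
    (\<Sum>j\<in>B. \<integral>\<^sup>+y. avg (\<lambda>e. of_bool (\<not> ?Q j e)) y \<partial>mix_law k d \<sigma> (a / sqrt (real k)) (insert j K))"
  proof (rule sum_avg_error_ge_half)
    \<comment> \<open>There are \<open>d - s + 1\<close> candidates, one more than the assumed bound
      asks for.\<close>
    show "cosh ((a / sqrt (real k))\<^sup>2 / \<sigma>\<^sup>2) ^ k \<le> real (card B) / 4"
      using X \<open>s < d\<close> unfolding B(3) by (simp add: of_nat_diff)
    show "i = j" if "i \<in> B" "j \<in> B" "supp d e = insert i K" "supp d e = insert j K" for i j e
      using that B(2) by blast
  qed (use assms B in simp_all)
  also have "\<dots> \<le> (\<Sum>j\<in>B. ?S)"
  proof (intro sum_mono mix_law_le_SUP)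
    fix j assume j: "j \<in> B"
    then have "j \<notin> K" and sub: "insert j K \<subseteq> {1..d}" using B assms(4,5) by (auto simp: K_def)
    then show "insert j K \<subseteq> {1..d}" "card (insert j K) = s" using assms(4) by (auto simp: K_def)
    fix \<theta> assume eta: "eta k d \<theta> = (\<lambda>i\<in>{1..d}. of_bool (i \<in> insert j K))"
    have "supp d (eta k d \<theta>) = insert j K" using sub unfolding eta supp_def by auto
    then show "(\<integral>\<^sup>+y. avg (\<lambda>e. of_bool (\<not> ?Q j e)) y \<partial>obs_law k d \<sigma> \<theta>) \<le> support_error k d \<sigma> (\<nu>, T) \<theta>"
      unfolding support_error_eq by simp
  qed (use assms in measurable)
  also have "\<dots> = ennreal (real (card B)) * ?S" by (simp add: ennreal_of_nat_eq_real_of_nat)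
  finally have "ennreal (real (card B)) * ennreal (1/2) \<le> ennreal (real (card B)) * ?S"
    by (subst ennreal_mult[symmetric]) simp_all
  then show ?thesis using B(3) by (subst (asm) ennreal_mult_le_mult_iff) auto
qed

end

section \<open>Hidden columns in disjoint blocks\<close>

text \<open>The configurations split into fibres on which all choices but the one at
  \<open>l\<close> are frozen, and the bound holds on each fibre. This reduces many blocks to
  one.\<close>

lemma sum_PiE_ge_half:
  fixes F :: "(nat \<Rightarrow> nat) \<Rightarrow> ennreal"
  assumes I: "finite I" "l \<in> I" and B: "\<And>i. i \<in> I \<Longrightarrow> finite (B i)" "card (B l) = m"
    and F: "\<And>J. J \<in> Pi\<^sub>E (I - {l}) B \<Longrightarrow> (\<Sum>j\<in>B l. F (J(l := j))) \<ge> ennreal (real m / 2)"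
  shows "(\<Sum>J\<in>Pi\<^sub>E I B. F J) \<ge> ennreal (real (card (Pi\<^sub>E I B)) / 2)"
proof -
  let ?I = "I - {l}"
  have ins: "insert l ?I = I" using I by auto
  have inj: "inj_on (\<lambda>(j, J). J(l := j)) (B l \<times> Pi\<^sub>E ?I B)"
    using inj_combinator[of l ?I] by simp
  have img: "Pi\<^sub>E I B = (\<lambda>(j, J). J(l := j)) ` (B l \<times> Pi\<^sub>E ?I B)"
    using PiE_insert_eq[of l ?I B] unfolding ins .
  have "card (Pi\<^sub>E I B) = m * card (Pi\<^sub>E ?I B)"
    unfolding img card_image[OF inj] by (simp add: card_cartesian_product B)
  then have "ennreal (real (card (Pi\<^sub>E I B)) / 2) = (\<Sum>J\<in>Pi\<^sub>E ?I B. ennreal (real m / 2))"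
    by (simp add: ennreal_of_nat_eq_real_of_nat ennreal_mult[symmetric] mult.commute del: card_PiE)
  also have "\<dots> \<le> (\<Sum>J\<in>Pi\<^sub>E ?I B. \<Sum>j\<in>B l. F (J(l := j)))"
    by (intro sum_mono F)
  also have "\<dots> = (\<Sum>j\<in>B l. \<Sum>J\<in>Pi\<^sub>E ?I B. F (J(l := j)))" by (rule sum.swap)
  also have "\<dots> = (\<Sum>J\<in>Pi\<^sub>E I B. F J)"
    unfolding img sum.reindex[OF inj] by (simp add: sum.cartesian_product case_prod_beta)
  finally show ?thesis .
qed

text \<open>Every wrong block contains a misclassified column, and disjointness of the blocks
  prevents double counting.\<close>

lemma sum_block_errors_le_hamming:
  fixes s :: nat and B :: "nat \<Rightarrow> nat set"
  assumes disj: "disjoint_family_on B {..<s}" and sub: "\<And>l. l < s \<Longrightarrow> B l \<subseteq> {1..d}"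
    and J: "\<And>l. l < s \<Longrightarrow> J l \<in> B l"
  shows "(\<Sum>l<s. of_bool (supp d e \<inter> B l \<noteq> {J l}))
    \<le> hamming d e (\<lambda>j\<in>{1..d}. of_bool (j \<in> J ` {..<s}))"
proof -
  let ?\<eta> = "\<lambda>j\<in>{1..d}. of_bool (j \<in> J ` {..<s}) :: nat"
  have "of_bool (supp d e \<inter> B l \<noteq> {J l}) \<le> (\<Sum>j\<in>B l. of_bool (e j \<noteq> ?\<eta> j) :: nat)"
    if l: "l < s" for l
  proof (cases "supp d e \<inter> B l = {J l}")
    case False
    have fin: "finite (B l)" using sub[OF l] by (rule finite_subset) simp
    \<comment> \<open>By disjointness no other block places its active column in
      \<open>B l\<close>.\<close>
    have mem: "j \<in> J ` {..<s} \<longleftrightarrow> j = J l" if j: "j \<in> B l" for j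
    proof
      assume "j \<in> J ` {..<s}"
      then obtain l' where l': "l' < s" "j = J l'" by auto
      then have "l' = l" using J[OF l'(1)] j l disj unfolding disjoint_family_on_def by blast
      then show "j = J l" using l' by simp
    qed (use l in auto)
    from False J[OF l] obtain j where j: "j \<in> B l" "j \<in> supp d e \<longleftrightarrow> j \<noteq> J l" by blast
    then have "e j \<noteq> ?\<eta> j" using mem[OF j(1)] sub[OF l] by (auto simp: supp_def)
    then have "1 \<le> (\<Sum>i\<in>{j}. of_bool (e i \<noteq> ?\<eta> i) :: nat)" by simp
    also have "\<dots> \<le> (\<Sum>j\<in>B l. of_bool (e j \<noteq> ?\<eta> j))"
      using fin j by (intro sum_mono2) auto
    finally show ?thesis by (simp add: False)
  qed simp
  then have "(\<Sum>l<s. of_bool (supp d e \<inter> B l \<noteq> {J l})) \<le> (\<Sum>l<s. \<Sum>j\<in>B l. of_bool (e j \<noteq> ?\<eta> j) :: nat)"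
    by (intro sum_mono) auto
  also have "\<dots> = (\<Sum>j\<in>(\<Union>l<s. B l). of_bool (e j \<noteq> ?\<eta> j))"
    using disj finite_subset[OF sub] by (intro sum.UNION_disjoint[symmetric])
      (auto simp: disjoint_family_on_def)
  also have "\<dots> \<le> (\<Sum>j=1..d. of_bool (e j \<noteq> ?\<eta> j))"
    using sub by (intro sum_mono2) auto
  finally show ?thesis unfolding hamming_def .
qed

context randomized_selector
begin

lemma SUP_hamming_risk_ge_half:
  assumes "0 < k" "0 < a" "\<sigma> > 0" "0 < m" "s * m \<le> d"
    and X: "cosh ((a / sqrt (real k))\<^sup>2 / \<sigma>\<^sup>2) ^ k \<le> real m / 4"
  shows "(SUP \<theta>\<in>Theta k d s a. hamming_risk k d \<sigma> (\<nu>, T) \<theta>) \<ge> ennreal (real s / 2)" (is "?S \<ge> _")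
proof -
  \<comment> \<open>Left-open intervals fit the column numbering from 1. Columns after
    \<open>s * m\<close> stay zero under all these configurations.\<close>
  define B where "B l = {l * m<..Suc l * m}" for l
  let ?I = "{..<s}" and ?b = "a / sqrt (real k)"
  let ?f = "\<lambda>l j. avg (\<lambda>e. of_bool (supp d e \<inter> B l \<noteq> {j}))"
  have sub: "B l \<subseteq> {1..d}" if "l < s" for l
  proof -
    have "Suc l * m \<le> s * m" using that by (intro mult_right_mono) auto
    then show ?thesis using assms(5) unfolding B_def by auto
  qed
  have card_B: "card (B l) = m" for l by (simp add: B_def)
  have disj: "disjoint_family_on B ?I"
  proof -
    have *: "B i \<inter> B j = {}" if "i < j" for i j
    proof -
      have "Suc i * m \<le> j * m" using that by (intro mult_right_mono) auto
      then show ?thesis by (auto simp: B_def)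
    qed
    show ?thesis unfolding disjoint_family_on_def
      by (metis * Int_commute linorder_neqE_nat)
  qed
  \<comment> \<open>Distinct blocks give distinct columns, so each configuration has exactly
    \<open>s\<close> active ones.\<close>
  have inj: "inj_on J ?I" if J: "J \<in> Pi\<^sub>E ?I B" for J
  proof (rule inj_onI)
    fix i j assume "i \<in> ?I" "j \<in> ?I" "J i = J j"
    then show "i = j"
      using PiE_mem[OF J, of i] PiE_mem[OF J, of j] disj unfolding disjoint_family_on_def by auto
  qed
  have ne: "Pi\<^sub>E ?I B \<noteq> {}" unfolding PiE_eq_empty_iff using assms(4) by (auto simp: B_def)
  have fin: "finite (Pi\<^sub>E ?I B)" by (rule finite_PiE) (simp_all add: B_def)
  let ?N = "real (card (Pi\<^sub>E ?I B))"
  \<comment> \<open>With the other choices frozen, this is the problem of one hidden column: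
    \<open>B l\<close> is the candidate set, and the active columns of the other blocks play the
    part of \<open>K\<close>.\<close>
  have block: "ennreal (?N / 2) \<le> (\<Sum>J\<in>Pi\<^sub>E ?I B. \<integral>\<^sup>+y. ?f l (J l) y \<partial>mix_law k d \<sigma> ?b (J ` ?I))"
    if l: "l < s" for l
  proof (rule sum_PiE_ge_half[where l = l])
    fix J assume J: "J \<in> Pi\<^sub>E (?I - {l}) B"
    let ?K = "J ` (?I - {l})"
    have "B l \<inter> {J i} = {}" if "i \<in> ?I - {l}" for i
      using PiE_mem[OF J that] that l disj unfolding disjoint_family_on_def by auto
    then have K: "B l \<inter> ?K = {}" by auto
    have img: "(J(l := j)) ` ?I = insert j ?K" for j 
      using l by (simp only: fun_upd_image lessThan_iff if_True)
    have "ennreal (real (card (B l)) / 2) \<le> (\<Sum>j\<in>B l. \<integral>\<^sup>+y. ?f l j y \<partial>mix_law k d \<sigma> ?b (insert j ?K))"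
    proof (rule sum_avg_error_ge_half[OF \<open>\<sigma> > 0\<close> sub[OF l] K])
      show "i = j" if "supp d e \<inter> B l = {i}" "supp d e \<inter> B l = {j}" for i j e
        using that by simp
      show "cosh (?b\<^sup>2 / \<sigma>\<^sup>2) ^ k \<le> real (card (B l)) / 4" using X by (simp only: card_B)
    qed
    then show "ennreal (real m / 2) \<le> (\<Sum>j\<in>B l. \<integral>\<^sup>+y. ?f l ((J(l := j)) l) y
        \<partial>mix_law k d \<sigma> ?b ((J(l := j)) ` ?I))"
      by (simp only: img card_B fun_upd_same)
  qed (use l card_B in \<open>auto simp: B_def\<close>)
  have "ennreal ?N * ennreal (real s / 2) = (\<Sum>l<s. ennreal (?N / 2))"
    by (simp add: ennreal_of_nat_eq_real_of_nat mult.commute flip: ennreal_mult)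
  also have "\<dots> \<le> (\<Sum>l<s. \<Sum>J\<in>Pi\<^sub>E ?I B. \<integral>\<^sup>+y. ?f l (J l) y \<partial>mix_law k d \<sigma> ?b (J ` ?I))"
    using block by (intro sum_mono) simp
  \<comment> \<open>After the exchange of sums, each configuration carries its total number of block
    errors, which the Hamming loss dominates.\<close>
  also have "\<dots> = (\<Sum>J\<in>Pi\<^sub>E ?I B. \<integral>\<^sup>+y. (\<Sum>l<s. ?f l (J l) y) \<partial>mix_law k d \<sigma> ?b (J ` ?I))"
    by (subst sum.swap) (simp add: nn_integral_sum)
  also have "\<dots> \<le> (\<Sum>J\<in>Pi\<^sub>E ?I B. ?S)"
  proof (intro sum_mono mix_law_le_SUP assms borel_measurable_sum borel_measurable_avg)
    fix J assume J: "J \<in> Pi\<^sub>E ?I B"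
    then have JB: "J l \<in> B l" if "l < s" for l using that by (auto intro: PiE_mem)
    then show "J ` ?I \<subseteq> {1..d}" using sub by blast
    show "card (J ` ?I) = s" using card_image[OF inj[OF J]] by simp
    fix \<theta> assume eta: "eta k d \<theta> = (\<lambda>j\<in>{1..d}. of_bool (j \<in> J ` ?I))"
    have "(\<Sum>l<s. of_bool (supp d e \<inter> B l \<noteq> {J l}))
      \<le> (of_nat (hamming d e (eta k d \<theta>)) :: ennreal)" for e
      using of_nat_mono[where 'a = ennreal, OF sum_block_errors_le_hamming[of B s d J e, OF disj sub JB]]
      unfolding eta by simp
    then have "avg (\<lambda>e. \<Sum>l<s. of_bool (supp d e \<inter> B l \<noteq> {J l})) y
      \<le> avg (\<lambda>e. of_nat (hamming d e (eta k d \<theta>))) y" for y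
      by (rule avg_mono)
    then have "(\<Sum>l<s. ?f l (J l) y) \<le> avg (\<lambda>e. of_nat (hamming d e (eta k d \<theta>))) y"
      if "y \<in> space (matrix_space k d)" for y
      unfolding avg_sum[OF that, of "\<lambda>l e. of_bool (supp d e \<inter> B l \<noteq> {J l})", symmetric] .
    then show "(\<integral>\<^sup>+y. (\<Sum>l<s. ?f l (J l) y) \<partial>obs_law k d \<sigma> \<theta>) \<le> hamming_risk k d \<sigma> (\<nu>, T) \<theta>"
      unfolding hamming_risk_eq
      by (intro nn_integral_mono) (simp only: sets_eq_imp_space_eq[OF sets_obs_law])
  qed
  also have "\<dots> = ennreal ?N * ?S" 
    by (simp only: sum_constant ennreal_of_nat_eq_real_of_nat)
  finally have "ennreal ?N * ennreal (real s / 2) \<le> ennreal ?N * ?S" .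
  moreover have "0 < ?N" using ne fin by (simp only: of_nat_0_less_iff card_gt_0_iff simp_thms)
  ultimately show ?thesis by (subst (asm) ennreal_mult_le_mult_iff) (simp_all del: card_PiE)
qed

end

text \<open>From \<open>exp 1 \<le> 3\<close> the first constant is at most \<open>4/9\<close>; the
  second is at most one half since \<open>exp (-1)\<close> is positive.\<close>

lemma error_constants_le_half:
  "(1 - exp (-1))\<^sup>2 \<le> (1/2 :: real)" "(1 - exp (-1)) / 2 \<le> (1/2 :: real)"
proof -
  have e: "1/3 \<le> exp (-1 :: real)" using exp_le by (simp add: exp_minus field_simps)
  have "(1 - exp (-1 :: real))\<^sup>2 \<le> (2/3)\<^sup>2" using e by (intro power_mono) auto
  then show "(1 - exp (-1))\<^sup>2 \<le> (1/2 :: real)" by (simp add: power2_eq_square)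
  show "(1 - exp (-1)) / 2 \<le> (1/2 :: real)" by simp
qed

section \<open>The minimax bounds\<close>

theorem theorem11:
  "\<exists>c\<^sub>1>0::real. \<exists>c\<^sub>2>0::real. \<forall>k d s :: nat. \<forall>a \<sigma> :: real.
     0 < k \<longrightarrow> 2 < d \<longrightarrow> 0 < s \<longrightarrow> s < d \<longrightarrow> 0 < a \<longrightarrow> 0 < \<sigma> \<longrightarrow>
     (real d - real s \<ge> c\<^sub>2 \<and>
        a\<^sup>2 < c\<^sub>1 * \<sigma>\<^sup>2 * max (ln (real d - real s)) (sqrt (real k * ln (real d - real s)))
      \<longrightarrow>
        (INF T\<in>selectors k d. SUP \<theta>\<in>Theta k d s a. hamming_risk k d \<sigma> T \<theta>)
          \<ge> (INF T\<in>selectors k d. SUP \<theta>\<in>Theta k d s a. support_error k d \<sigma> T \<theta>)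
      \<and> (INF T\<in>selectors k d. SUP \<theta>\<in>Theta k d s a. support_error k d \<sigma> T \<theta>)
          \<ge> ennreal ((1 - exp (-1))\<^sup>2))
   \<and> (real d / real s \<ge> c\<^sub>2 \<and>
        a\<^sup>2 < c\<^sub>1 * \<sigma>\<^sup>2 * max (ln ((real d - real s) / real s))
                             (sqrt (real k * ln ((real d - real s) / real s)))
      \<longrightarrow>
        (INF T\<in>selectors k d. SUP \<theta>\<in>Theta k d s a. ennreal (1 / real s) * hamming_risk k d \<sigma> T \<theta>)
          \<ge> ennreal ((1 - exp (-1)) / 2))"
\<comment> \<open>The factor \<open>1/2\<close> makes the second moment at most the square root of
  the number of positions. The value 17 leaves 16 after the loss of 1 in
  \<open>d / s - 1\<close>.\<close>
proof (rule exI[of _ "1/2 :: real"], rule conjI, simp, rule exI[of _ "17 :: real"], rule conjI, simp,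
    (intro conjI allI impI; elim conjE))
  fix k d s :: nat and a \<sigma> :: real
  show "(INF T\<in>selectors k d. SUP \<theta>\<in>Theta k d s a. support_error k d \<sigma> T \<theta>)
    \<le> (INF T\<in>selectors k d. SUP \<theta>\<in>Theta k d s a. hamming_risk k d \<sigma> T \<theta>)"
  \<comment> \<open>The same selector serves on both sides.\<close>
  proof (rule INF_mono, rule bexI)
    fix T assume T: "T \<in> selectors k d"
    then interpret randomized_selector k d "fst T" "snd T" by unfold_locales simp
    show "(SUP \<theta>\<in>Theta k d s a. support_error k d \<sigma> T \<theta>) \<le> (SUP \<theta>\<in>Theta k d s a. hamming_risk k d \<sigma> T \<theta>)"
      using support_error_le_hamming_risk by (intro SUP_mono) auto
  qed
next
  fix k d s :: nat and a \<sigma> :: real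
  assume pos: "0 < k" "0 < s" "s < d" "0 < a" "0 < \<sigma>"
    and ds: "17 \<le> real d - real s"
    and a: "a\<^sup>2 < 1/2 * \<sigma>\<^sup>2 * max (ln (real d - real s)) (sqrt (real k * ln (real d - real s)))"
  have X: "cosh ((a / sqrt (real k))\<^sup>2 / \<sigma>\<^sup>2) ^ k \<le> (real d - real s) / 4"
    by (rule cosh_power_le_quarter[OF _ _ _ _ _ a]) (use pos ds in auto)
  show "ennreal ((1 - exp (-1))\<^sup>2)
    \<le> (INF T\<in>selectors k d. SUP \<theta>\<in>Theta k d s a. support_error k d \<sigma> T \<theta>)"
  proof (rule INF_greatest)
    fix T assume "T \<in> selectors k d"
    then interpret randomized_selector k d "fst T" "snd T" by unfold_locales simp
    have "ennreal ((1 - exp (-1))\<^sup>2) \<le> ennreal (1/2)"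
      by (intro ennreal_leI error_constants_le_half)
    also have "\<dots> \<le> (SUP \<theta>\<in>Theta k d s a. support_error k d \<sigma> T \<theta>)"
      using SUP_support_error_ge_half[OF pos(1,4,5,2,3) X] by simp
    finally show "ennreal ((1 - exp (-1))\<^sup>2) \<le> (SUP \<theta>\<in>Theta k d s a. support_error k d \<sigma> T \<theta>)" .
  qed
next
  fix k d s :: nat and a \<sigma> :: real
  assume pos: "0 < k" "0 < s" "s < d" "0 < a" "0 < \<sigma>"
    and ds: "17 \<le> real d / real s"
    and a: "a\<^sup>2 < 1/2 * \<sigma>\<^sup>2 * max (ln ((real d - real s) / real s))
      (sqrt (real k * ln ((real d - real s) / real s)))"
  have r: "(real d - real s) / real s = real d / real s - 1" using pos by (simp add: field_simps)
  \<comment> \<open>Rounding down costs at most 1, exactly the gap between \<open>d / s\<close> and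
    \<open>(d - s) / s\<close>.\<close>
  have m: "real d / real s - 1 \<le> real (d div s)"
    using floor_divide_of_nat_eq[of d s, where 'a = real] by linarith
  have X: "cosh ((a / sqrt (real k))\<^sup>2 / \<sigma>\<^sup>2) ^ k \<le> real (d div s) / 4"
    by (rule cosh_power_le_quarter[OF _ _ _ _ _ a]) (use pos ds m in \<open>auto simp: r\<close>)
  show "ennreal ((1 - exp (-1)) / 2)
    \<le> (INF T\<in>selectors k d. SUP \<theta>\<in>Theta k d s a. ennreal (1 / real s) * hamming_risk k d \<sigma> T \<theta>)"
  proof (rule INF_greatest)
    fix T assume "T \<in> selectors k d"
    then interpret randomized_selector k d "fst T" "snd T" by unfold_locales simp
    have "0 < d div s" using ds m by linarith
    then have *: "ennreal (real s / 2) \<le> (SUP \<theta>\<in>Theta k d s a. hamming_risk k d \<sigma> T \<theta>)"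
      using SUP_hamming_risk_ge_half[OF pos(1,4,5) _ _ X, of s] by simp
    have "ennreal ((1 - exp (-1)) / 2) \<le> ennreal (1/2)"
      by (intro ennreal_leI error_constants_le_half)
    also have "\<dots> = ennreal (1 / real s) * ennreal (real s / 2)"
      using pos by (simp flip: ennreal_mult)
    also have "\<dots> \<le> ennreal (1 / real s) * (SUP \<theta>\<in>Theta k d s a. hamming_risk k d \<sigma> T \<theta>)"
      using * by (intro mult_left_mono) auto
    also have "\<dots> = (SUP \<theta>\<in>Theta k d s a. ennreal (1 / real s) * hamming_risk k d \<sigma> T \<theta>)"
      by (rule SUP_mult_left_ennreal)
    finally show "ennreal ((1 - exp (-1)) / 2)
      \<le> (SUP \<theta>\<in>Theta k d s a. ennreal (1 / real s) * hamming_risk k d \<sigma> T \<theta>)" .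
  qed
qed

end
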